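(* Let $T_n$ be the wakeup time of the frog model on the complete graph $K_n$ with $n$ vertices. Then $\mathbf{E}\, T_n = \Theta(\log n)$ as $n \to \infty$.
   Context: The frog model on $K_n$ ($n \ge 2$) is defined as follows. Let $V$ be the vertex set of $K_n$, with a distinguished root $v_0 \in V$. There is one awake frog at the root and one sleeping frog at every other vertex; in discrete time, awake frogs perform independent simple random walks (each step goes to a uniformly chosen one of the $n-1$ other vertices) and wake any sleeping frog at a vertex they visit. Formally, let $\{F_v(t) : v \in V\}$, $t = 0,1,2,\ldots$, be independent simple random walks on $K_n$ with $F_v(0)=v$. Define $t(v,u) = \min\{t \ge 0 : F_v(t) = u\}$ and $$T(v,u) = \inf\Big\{\sum_{i=1}^k t(v_{i-1},v_i) : v_0 = v, \ldots, v_k = u \text{ for some } k\Big\}$$ (here, inside the infimum, $v_0,\dots,v_k$ ranges over finite sequences of vertices from $v$ to $u$). With $v_0$ the root, $T(v_0,u)$ is the time at which the frog at $u$ is woken. Let $\Lambda(t) = \{u \in V : T(v_0,u) \le t\}$ be the set of visited vertices (equivalently, of awake frogs) at time $t$, let $N_t = |\Lambda(t)|$, and let $T_n = \inf\{t : N_t = n\}$. Asymptotic notation: $f(n) = O(g(n))$ if there is $c>0$ with $f(n) \le c\, g(n)$ for all sufficiently large $n$; $f(n) = \Theta(g(n))$ if $f(n) = O(g(n))$ and $g(n) = O(f(n))$. *)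

theory Defs
  imports "HOL-Probability.Probability" "HOL-Library.Landau_Symbols"
begin

text \<open>
  The process \<open>X\<close> is a simple random walk on the complete graph with vertex set \<open>V\<close>,
  started at \<open>v\<close>: given any history, the next position is uniform on the other vertices.
  A history of probability zero imposes no condition.
\<close>

definition srw_complete :: "'w measure \<Rightarrow> 'v set \<Rightarrow> 'v \<Rightarrow> (nat \<Rightarrow> 'w \<Rightarrow> 'v) \<Rightarrow> bool" where
  "srw_complete M V v X \<longleftrightarrow>
     (\<forall>t. X t \<in> measurable M (count_space V)) \<and>
     (\<forall>\<omega>\<in>space M. X 0 \<omega> = v) \<and>
     (\<forall>t x y.
        measure M {\<omega> \<in> space M. (\<forall>i\<le>t. X i \<omega> = x i) \<and> X (Suc t) \<omega> = y} =
        measure M {\<omega> \<in> space M. \<forall>i\<le>t. X i \<omega> = x i} * pmf (pmf_of_set (V - {x t})) y)"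

locale frog_model = prob_space M
  for M :: "'w measure" +
  fixes V :: "'v set" and v0 :: 'v and F :: "'v \<Rightarrow> nat \<Rightarrow> 'w \<Rightarrow> 'v"
  assumes finite_V: "finite V"
    and card_V: "card V \<ge> 2"
    and v0_in_V: "v0 \<in> V"
    and srw: "\<And>v. v \<in> V \<Longrightarrow> srw_complete M V v (F v)"
    and indep: "indep_vars (\<lambda>_. Pi\<^sub>M UNIV (\<lambda>_::nat. count_space V)) (\<lambda>v \<omega> t. F v t \<omega>) V"

text \<open>
  The following functionals act on a single realisation \<open>f\<close>, where \<open>f v t\<close> is the position
  at time \<open>t\<close> of the walk started at \<open>v\<close>.  Times are extended naturals, so the infimum
  of the empty set is \<open>\<infinity>\<close>.
\<close>

definition hitting_time :: "('v \<Rightarrow> nat \<Rightarrow> 'v) \<Rightarrow> 'v \<Rightarrow> 'v \<Rightarrow> enat" where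
  "hitting_time f v u = Inf {enat t | t. f v t = u}"

definition passage_time :: "'v set \<Rightarrow> ('v \<Rightarrow> nat \<Rightarrow> 'v) \<Rightarrow> 'v \<Rightarrow> 'v \<Rightarrow> enat" where
  "passage_time V f v u =
     Inf {\<Sum>i=1..k. hitting_time f (p (i - 1)) (p i) | (k::nat) (p::nat \<Rightarrow> 'v).
            (\<forall>i\<le>k. p i \<in> V) \<and> p 0 = v \<and> p k = u}"

definition visited :: "'v set \<Rightarrow> 'v \<Rightarrow> ('v \<Rightarrow> nat \<Rightarrow> 'v) \<Rightarrow> nat \<Rightarrow> 'v set" where
  "visited V v0 f t = {u \<in> V. passage_time V f v0 u \<le> enat t}"

definition wakeup_time :: "'v set \<Rightarrow> 'v \<Rightarrow> ('v \<Rightarrow> nat \<Rightarrow> 'v) \<Rightarrow> enat" where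
  "wakeup_time V v0 f = Inf {enat t | t. card (visited V v0 f t) = card V}"

definition expected_wakeup_time ::
    "'w measure \<Rightarrow> 'v set \<Rightarrow> 'v \<Rightarrow> ('v \<Rightarrow> nat \<Rightarrow> 'w \<Rightarrow> 'v) \<Rightarrow> ennreal" where
  "expected_wakeup_time M V v0 F =
     (\<integral>\<^sup>+\<omega>. ennreal_of_enat (wakeup_time V v0 (\<lambda>v t. F v t \<omega>)) \<partial>M)"

end

theory Submission
  imports Defs
begin

text \<open>
  Each awake frog wakes at most one frog per step, so \<open>N\<^bsub>t+1\<^esub> \<le> 2 N\<^sub>t\<close> and
  \<open>T\<^sub>n \<ge> log\<^sub>2 n\<close> surely.

  For the upper bound let \<open>\<Phi> k = n / k - 1\<close>.  Given the past up to time \<open>t\<close>, with \<open>k\<close> frogs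
  awake, a sleeping frog is woken in the next step with probability
  \<open>1 - (1 - 1 / (n - 1))\<^sup>k \<ge> k / (2 n)\<close>, while the number \<open>X\<close> of frogs woken is at most \<open>k\<close>, so that
  \<open>1 / (k + X) \<le> 1 / k - X / (2 k\<^sup>2)\<close> by convexity.  Taking expectations gives
  \<open>E \<Phi>(N\<^bsub>t+1\<^esub>) \<le> 3/4 E \<Phi>(N\<^sub>t)\<close>.  As \<open>\<Phi> \<ge> 1 / n\<close> while some frog sleeps,
  \<open>P(T\<^sub>n > t) \<le> n\<^sup>2 (3/4)\<^sup>t\<close>, and summing the minimum of this and \<open>1\<close> over \<open>t\<close> gives \<open>O(log n)\<close>.
\<close>

section \<open>Passage times along a single realisation\<close>

text \<open>Well-ordering: a finite infimum is attained, so finite hitting, passage and wakeup times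
  come with witnesses.\<close>

lemma Inf_enat_eqD:
  assumes "Inf A = enat s"
  shows "enat s \<in> A"
  using assms unfolding Inf_enat_def by (metis LeastI_ex ex_in_conv enat.distinct(2))

lemma hitting_time_le: "f v t = u \<Longrightarrow> hitting_time f v u \<le> enat t"
  unfolding hitting_time_def by (rule Inf_lower) auto

lemma hitting_time_eqD: "hitting_time f v u = enat t \<Longrightarrow> f v t = u"
  unfolding hitting_time_def by (drule Inf_enat_eqD) auto

lemma passage_time_le:
  fixes k :: nat and p :: "nat \<Rightarrow> 'v"
  assumes "\<And>i. i \<le> k \<Longrightarrow> p i \<in> V" "p 0 = v" "p k = u"
  shows "passage_time V f v u \<le> (\<Sum>i=1..k. hitting_time f (p (i - 1)) (p i))"
  unfolding passage_time_def using assms by (intro Inf_lower) blast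

lemma passage_time_eqD:
  fixes V :: "'v set"
  assumes "passage_time V f v u = enat s"
  obtains k :: nat and p :: "nat \<Rightarrow> 'v" where "\<forall>i\<le>k. p i \<in> V" "p 0 = v" "p k = u"
    "(\<Sum>i=1..k. hitting_time f (p (i - 1)) (p i)) = enat s"
proof -
  from Inf_enat_eqD[OF assms[unfolded passage_time_def]] obtain k :: nat and p :: "nat \<Rightarrow> 'v" where
    "enat s = (\<Sum>i=1..k. hitting_time f (p (i - 1)) (p i))"
    "\<forall>i\<le>k. p i \<in> V" "p 0 = v" "p k = u" by blast
  then show thesis by (intro that[of k p]) auto
qed

lemma passage_time_self: "v \<in> V \<Longrightarrow> passage_time V f v v = 0"
  using passage_time_le[of 0 "\<lambda>_. v" V v v f] by simp

lemma passage_time_triangle: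
  assumes "w \<in> V"
  shows "passage_time V f u w \<le> passage_time V f u v + hitting_time f v w"
proof (cases "passage_time V f u v")
  case (enat s)
  then obtain k :: nat and p where p: "\<forall>i\<le>k. p i \<in> V" "p 0 = u" "p k = v"
    "(\<Sum>i=1..k. hitting_time f (p (i - 1)) (p i)) = enat s"
    by (rule passage_time_eqD)
  let ?q = "p(Suc k := w)"
  have "passage_time V f u w \<le> (\<Sum>i=1..Suc k. hitting_time f (?q (i - 1)) (?q i))"
    using p assms by (intro passage_time_le) auto
  also have "\<dots> = (\<Sum>i=1..k. hitting_time f (?q (i - 1)) (?q i)) + hitting_time f v w"
    using p by simp
  also have "(\<Sum>i=1..k. hitting_time f (?q (i - 1)) (?q i)) =
      (\<Sum>i=1..k. hitting_time f (p (i - 1)) (p i))"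
    by (intro sum.cong) auto
  finally show ?thesis using p enat by simp
qed simp

text \<open>Take an optimal path and its last hop of positive length. The strict
  \<open>r < s\<close> makes the waker earlier than \<open>u\<close>, which is what the recursion
  over time rests on.\<close>

lemma passage_time_last_step:
  fixes V :: "'v set"
  assumes f0: "\<forall>v\<in>V. f v 0 = v"
    and s: "passage_time V f v0 u = enat s" and u: "u \<noteq> v0"
  shows "\<exists>v\<in>V. \<exists>r<s. passage_time V f v0 v = enat r \<and> f v (s - r) = u"
proof -
  have *: "\<exists>v\<in>V. \<exists>r<s. passage_time V f v0 v = enat r \<and> f v (s - r) = u"
    if "\<And>i. i \<le> k \<Longrightarrow> p i \<in> V" "p 0 = v0" "p k = u"
      "(\<Sum>i=1..k. hitting_time f (p (i - 1)) (p i)) = enat s" for k :: nat and p :: "nat \<Rightarrow> 'v"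
    using that
  proof (induction k)
    case 0
    then show ?case using u by simp
  next
    case (Suc k)
    let ?S = "\<Sum>i=1..k. hitting_time f (p (i - 1)) (p i)"
    have sum: "?S + hitting_time f (p k) u = enat s"
      using Suc.prems by simp
    then obtain a j where aj: "?S = enat a" "hitting_time f (p k) u = enat j" "a + j = s"
      by (cases ?S; cases "hitting_time f (p k) u") auto
    have hit: "f (p k) j = u" using aj by (simp add: hitting_time_eqD)
    have pk: "p k \<in> V" "u \<in> V" using Suc.prems(1)[of k] Suc.prems(1)[of "Suc k"] Suc.prems(3) by auto
    show ?case
    \<comment> \<open>A hop of length zero stays in place because \<open>f v 0 = v\<close>, so the
      path without it also realises \<open>s\<close>.\<close>
    proof (cases "j = 0")
      case True
      then have "p k = u" using hit f0 pk by simp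
      then show ?thesis using Suc.IH Suc.prems aj True by auto
    next
      case False
      have le: "passage_time V f v0 (p k) \<le> enat a"
        using passage_time_le[of k p V v0 "p k" f] Suc.prems aj by simp
      then obtain r where r: "passage_time V f v0 (p k) = enat r" "r \<le> a"
        by (cases "passage_time V f v0 (p k)") auto
      \<comment> \<open>A prefix that were not optimal could be replaced by a cheaper one, giving a
        path to \<open>u\<close> shorter than \<open>s\<close>.\<close>
      have "enat s \<le> enat r + enat j"
        using passage_time_triangle[OF pk(2), of f v0 "p k"] s r aj by simp
      then have "r = a" using r aj by simp
      then show ?thesis using r aj hit pk False by (intro bexI[of _ "p k"] exI[of _ r]) auto
    qed
  qed
  from s show ?thesis by (rule passage_time_eqD) (use * in blast)
qed

section \<open>The visited sets and their one-step recursion\<close>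

lemma visited_subset: "visited V v0 f t \<subseteq> V"
  by (auto simp: visited_def)

lemma visited_mono: "s \<le> t \<Longrightarrow> visited V v0 f s \<subseteq> visited V v0 f t"
  by (auto simp: visited_def intro: order_trans)

lemma root_visited: "v0 \<in> V \<Longrightarrow> v0 \<in> visited V v0 f t"
  by (simp add: visited_def passage_time_self zero_enat_def[symmetric])

lemma visited_passage_time:
  assumes "v \<in> visited V v0 f t"
  obtains r where "passage_time V f v0 v = enat r" "r \<le> t"
  using assms by (cases "passage_time V f v0 v") (auto simp: visited_def)

lemma visited_0:
  assumes "\<forall>v\<in>V. f v 0 = v" "v0 \<in> V"
  shows "visited V v0 f 0 = {v0}"
proof -
  have "u = v0" if "u \<in> visited V v0 f 0" for u
  proof (rule ccontr)
    assume "u \<noteq> v0"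
    moreover from that obtain r where "passage_time V f v0 u = enat r" "r \<le> 0"
      by (rule visited_passage_time)
    ultimately show False using passage_time_last_step[of V f v0 u r] assms(1) by auto
  qed
  then show ?thesis using root_visited[OF assms(2)] by blast
qed

text \<open>A vertex first visited at \<open>Suc t\<close> has passage time exactly
  \<open>Suc t\<close>, so its last hop starts from a frog woken by time \<open>t\<close>; the
  converse is the triangle inequality. The intersection with \<open>V\<close> appears because
  \<open>f\<close> is an arbitrary function here and may leave \<open>V\<close>.\<close>

lemma visited_Suc:
  assumes f0: "\<forall>v\<in>V. f v 0 = v" and v0: "v0 \<in> V"
  shows "visited V v0 f (Suc t) = visited V v0 f t \<union>
    V \<inter> (\<lambda>v. f v (Suc t - the_enat (passage_time V f v0 v))) ` visited V v0 f t"
    (is "?L = ?A \<union> V \<inter> ?g ` ?A")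
proof (intro Set.equalityI subsetI)
  fix u assume u: "u \<in> ?L"
  show "u \<in> ?A \<union> V \<inter> ?g ` ?A"
  proof (cases "u \<in> ?A")
    case False
    from u obtain r where "passage_time V f v0 u = enat r" "r \<le> Suc t"
      by (rule visited_passage_time)
    with False u have r: "passage_time V f v0 u = enat (Suc t)" "u \<in> V"
      by (auto simp: visited_def le_Suc_eq)
    have "u \<noteq> v0" using False root_visited[OF v0] by auto
    from passage_time_last_step[OF f0 r(1) this] obtain v s where
      "v \<in> V" "s < Suc t" "passage_time V f v0 v = enat s" "f v (Suc t - s) = u" by auto
    then show ?thesis using r by (auto simp: visited_def intro!: rev_image_eqI[of v])
  qed simp
next
  fix u assume "u \<in> ?A \<union> V \<inter> ?g ` ?A"
  then show "u \<in> ?L"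
  proof
    assume "u \<in> ?A" then show ?thesis using visited_mono[of t "Suc t" V v0 f] by auto
  next
    assume "u \<in> V \<inter> ?g ` ?A"
    then obtain v where v: "v \<in> ?A" "u = ?g v" "u \<in> V" by auto
    from v(1) obtain r where r: "passage_time V f v0 v = enat r" "r \<le> t"
      by (rule visited_passage_time)
    have "passage_time V f v0 u \<le> enat r + hitting_time f v u"
      using passage_time_triangle[OF v(3), of f v0 v] r by simp
    also have "\<dots> \<le> enat r + enat (Suc t - r)"
      using hitting_time_le[of f v "Suc t - r" u] v r by (intro add_left_mono) simp
    finally have "passage_time V f v0 u \<le> enat r + enat (Suc t - r)" .
    then show ?thesis using v r by (simp add: visited_def)
  qed
qed

lemma card_visited_Suc_le:
  assumes "\<forall>v\<in>V. f v 0 = v" "v0 \<in> V" "finite V"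
  shows "card (visited V v0 f (Suc t)) \<le> 2 * card (visited V v0 f t)"
proof -
  let ?A = "visited V v0 f t"
  let ?B = "(\<lambda>v. f v (Suc t - the_enat (passage_time V f v0 v))) ` ?A"
  have fin: "finite ?A" by (rule finite_subset[OF visited_subset assms(3)])
  have "card (?A \<union> V \<inter> ?B) \<le> card ?A + card (V \<inter> ?B)"
    by (rule card_Un_le)
  also have "card (V \<inter> ?B) \<le> card ?B"
    using fin by (intro card_mono) simp_all
  also have "card ?B \<le> card ?A" by (rule card_image_le[OF fin])
  finally show ?thesis using visited_Suc[of V f v0 t] assms by simp
qed

lemma card_visited_le:
  assumes "\<forall>v\<in>V. f v 0 = v" "v0 \<in> V" "finite V"
  shows "card (visited V v0 f t) \<le> 2 ^ t"
proof (induction t)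
  case 0
  then show ?case using visited_0[of V f v0] assms by simp
next
  case (Suc t)
  then show ?case using card_visited_Suc_le[of V f v0 t] assms by simp
qed

section \<open>Ages, and dependence on initial segments of the walks\<close>

text \<open>The number of steps the frog from \<open>v\<close> has made by time \<open>t\<close>; it is \<open>0\<close> for a sleeping frog.\<close>

definition age :: "'v set \<Rightarrow> 'v \<Rightarrow> ('v \<Rightarrow> nat \<Rightarrow> 'v) \<Rightarrow> nat \<Rightarrow> 'v \<Rightarrow> nat" where
  "age V v0 f t v =
     (if v \<in> visited V v0 f t then t - the_enat (passage_time V f v0 v) else 0)"

lemma age_le: "age V v0 f t v \<le> t"
  by (simp add: age_def)

lemma Suc_age:
  assumes "v \<in> visited V v0 f t"
  shows "Suc t - the_enat (passage_time V f v0 v) = Suc (age V v0 f t v)"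
proof -
  obtain r where "passage_time V f v0 v = enat r" "r \<le> t"
    using assms by (rule visited_passage_time)
  then show ?thesis using assms by (simp add: age_def Suc_diff_le)
qed

text \<open>The passage time of \<open>v\<close> is the first index at which \<open>v\<close> is
  visited, so the growing family of visited sets determines it.\<close>

lemma passage_time_eq_if_visited_eq:
  assumes "\<And>r. r \<le> s \<Longrightarrow> visited V v0 f r = visited V v0 g r" "v \<in> visited V v0 f s"
  shows "passage_time V f v0 v = passage_time V g v0 v"
proof -
  obtain a where a: "passage_time V f v0 v = enat a" "a \<le> s"
    using assms(2) by (rule visited_passage_time)
  have "v \<in> visited V v0 g s" using assms by auto
  then obtain b where b: "passage_time V g v0 v = enat b" "b \<le> s"
    by (rule visited_passage_time)
  have "v \<in> V" by (rule subsetD[OF visited_subset assms(2)])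
  with a b have "v \<in> visited V v0 f a" "v \<in> visited V v0 g b" by (simp_all add: visited_def)
  then have "v \<in> visited V v0 g a" "v \<in> visited V v0 f b"
    using assms(1)[OF a(2)] assms(1)[OF b(2)] by simp_all
  then have "b \<le> a" "a \<le> b" using a b by (simp_all add: visited_def)
  then show ?thesis using a b by simp
qed

text \<open>The stopping-time property: up to time \<open>t\<close> each walk is read only up to the
  age of its frog, so agreement on these segments, with ages computed from \<open>f\<close> alone,
  fixes the visited sets.\<close>

lemma visited_cong:
  assumes f0: "\<forall>v\<in>V. f v 0 = v" and g0: "\<forall>v\<in>V. g v 0 = v" and v0: "v0 \<in> V"
    and agree: "\<forall>v\<in>V. \<forall>i\<le>age V v0 f t v. f v i = g v i"
  shows "s \<le> t \<Longrightarrow> visited V v0 f s = visited V v0 g s"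
proof (induction s rule: less_induct)
  case (less s)
  show ?case
  proof (cases s)
    case 0
    then show ?thesis using visited_0[of V f v0] visited_0[of V g v0] f0 g0 v0 by simp
  next
    case (Suc r)
    have eq: "visited V v0 f q = visited V v0 g q" if "q \<le> r" for q
      using less that Suc by auto
    have "f v (Suc r - the_enat (passage_time V f v0 v)) = g v (Suc r - the_enat (passage_time V g v0 v))"
      if v: "v \<in> visited V v0 f r" for v
    proof -
      have "v \<in> visited V v0 f t" using v visited_mono[of r t V v0 f] less.prems Suc by auto
      then have "age V v0 f t v = t - the_enat (passage_time V f v0 v)" by (simp add: age_def)
      \<comment> \<open>Since \<open>Suc r \<le> t\<close>, the index read in this step does not
        exceed the age at time \<open>t\<close>.\<close>
      then have "Suc r - the_enat (passage_time V f v0 v) \<le> age V v0 f t v"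
        using less.prems Suc by simp
      moreover have "v \<in> V" by (rule subsetD[OF visited_subset v])
      ultimately have "f v (Suc r - the_enat (passage_time V f v0 v)) =
          g v (Suc r - the_enat (passage_time V f v0 v))"
        using agree by blast
      moreover have "passage_time V f v0 v = passage_time V g v0 v"
        using eq v by (rule passage_time_eq_if_visited_eq)
      ultimately show ?thesis by (simp only:)
    qed
    then have "(\<lambda>v. f v (Suc r - the_enat (passage_time V f v0 v))) ` visited V v0 f r =
        (\<lambda>v. g v (Suc r - the_enat (passage_time V g v0 v))) ` visited V v0 f r"
      by (rule image_cong[OF refl])
    then show ?thesis
      unfolding Suc visited_Suc[of V f v0, OF f0 v0] visited_Suc[of V g v0, OF g0 v0]
      by (simp only: eq[OF order_refl])
  qed
qed

text \<open>Equality of the ages makes the agreement hypothesis symmetric in \<open>f\<close> and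
  \<open>g\<close>, so either the walks or a stored history can serve as the reference.\<close>

lemma age_cong:
  assumes "\<forall>v\<in>V. f v 0 = v" "\<forall>v\<in>V. g v 0 = v" "v0 \<in> V"
    and "\<forall>v\<in>V. \<forall>i\<le>age V v0 f t v. f v i = g v i"
  shows "age V v0 f t v = age V v0 g t v"
proof -
  have eq: "visited V v0 f s = visited V v0 g s" if "s \<le> t" for s
    using assms that by (rule visited_cong)
  show ?thesis
    unfolding age_def eq[OF order_refl, symmetric]
    using passage_time_eq_if_visited_eq[of t V v0 f g v, OF eq]
    by (intro if_cong refl) (simp only:)
qed

section \<open>Histories of the awake frogs\<close>

context frog_model
begin

abbreviation realisation :: "'w \<Rightarrow> 'v \<Rightarrow> nat \<Rightarrow> 'v" where
  "realisation \<omega> \<equiv> \<lambda>v t. F v t \<omega>"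

abbreviation awake :: "nat \<Rightarrow> 'w \<Rightarrow> 'v set" where
  "awake t \<omega> \<equiv> visited V v0 (realisation \<omega>) t"

text \<open>
  The walks stopped at the ages of their frogs.  The ages are determined by the stopped walks,
  so fixing the history fixes an initial segment of each walk, and by independence the next
  steps of the awake frogs remain free.
\<close>

definition history :: "nat \<Rightarrow> 'w \<Rightarrow> 'v \<times> nat \<Rightarrow> 'v" where
  "history t \<omega> =
     (\<lambda>(v, i)\<in>V \<times> {..t}. F v (min i (age V v0 (realisation \<omega>) t v)) \<omega>)"

lemma F_measurable: "v \<in> V \<Longrightarrow> F v t \<in> measurable M (count_space V)"
  using srw by (auto simp: srw_complete_def)

lemma F_in_V: "v \<in> V \<Longrightarrow> \<omega> \<in> space M \<Longrightarrow> F v t \<omega> \<in> V"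
  using measurable_space[OF F_measurable] by auto

lemma F_event:
  assumes "v \<in> V"
  shows "{\<omega> \<in> space M. F v i \<omega> = c} \<in> events"
proof -
  have "{\<omega> \<in> space M. F v i \<omega> = c} = F v i -` ({c} \<inter> V) \<inter> space M"
    using F_in_V[OF assms] by auto
  then show ?thesis using measurable_sets[OF F_measurable[OF assms], of "{c} \<inter> V"] by simp
qed

lemma F_0: "\<omega> \<in> space M \<Longrightarrow> \<forall>v\<in>V. F v 0 \<omega> = v"
  using srw by (auto simp: srw_complete_def)

lemma V_nonempty: "V \<noteq> {}"
  using v0_in_V by auto

lemma history_0: "\<omega> \<in> space M \<Longrightarrow> \<forall>v\<in>V. curry (history t \<omega>) v 0 = v"
  using F_0 by (auto simp: history_def)

lemma history_agrees:
  "\<forall>v\<in>V. \<forall>i\<le>age V v0 (realisation \<omega>) t v. realisation \<omega> v i = curry (history t \<omega>) v i"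
  using age_le[of V v0 "realisation \<omega>" t] by (auto simp: history_def min_def intro: order_trans)

text \<open>Past the age the history repeats the last position, and outside its domain it is
  \<open>undefined\<close>; neither is read by the dynamics up to time \<open>t\<close>.\<close>

lemma visited_history:
  assumes "\<omega> \<in> space M" "s \<le> t"
  shows "visited V v0 (curry (history t \<omega>)) s = awake s \<omega>"
  using visited_cong[of V "realisation \<omega>" "curry (history t \<omega>)" v0 t s]
    F_0[OF assms(1)] history_0[OF assms(1)] v0_in_V history_agrees assms(2) by simp

lemma age_history:
  assumes "\<omega> \<in> space M"
  shows "age V v0 (curry (history t \<omega>)) t v = age V v0 (realisation \<omega>) t v"
  using age_cong[of V "realisation \<omega>" "curry (history t \<omega>)" v0 t v]
    F_0[OF assms(1)] history_0[OF assms(1)] v0_in_V history_agrees by simp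

lemma history_PiE: "\<omega> \<in> space M \<Longrightarrow> history t \<omega> \<in> (V \<times> {..t}) \<rightarrow>\<^sub>E V"
  using F_in_V by (auto simp: history_def)

lemma finite_histories: "finite (history t ` space M)"
  by (rule finite_subset[of _ "(V \<times> {..t}) \<rightarrow>\<^sub>E V"])
    (use history_PiE finite_V in \<open>auto intro!: finite_PiE\<close>)

text \<open>For an attained \<open>h\<close> the history event becomes an intersection over
  \<open>v\<close> of conditions on single walks, along segments whose lengths depend only on
  \<open>h\<close>. Independence applies to this form.\<close>

lemma history_eq_iff:
  assumes \<omega>: "\<omega> \<in> space M" and h: "h \<in> history t ` space M"
  shows "history t \<omega> = h \<longleftrightarrow> (\<forall>v\<in>V. \<forall>i\<le>age V v0 (curry h) t v. F v i \<omega> = h (v, i))"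
proof
  assume "history t \<omega> = h"
  then show "\<forall>v\<in>V. \<forall>i\<le>age V v0 (curry h) t v. F v i \<omega> = h (v, i)"
    using history_agrees[of \<omega> t] age_history[OF \<omega>, of t] by auto
next
  assume agree: "\<forall>v\<in>V. \<forall>i\<le>age V v0 (curry h) t v. F v i \<omega> = h (v, i)"
  from h obtain \<omega>' where \<omega>': "\<omega>' \<in> space M" "h = history t \<omega>'" by auto
  \<comment> \<open>With \<open>curry h\<close> as the reference, agreement along its own ages
    already forces the ages under \<omega> to match.\<close>
  have age: "age V v0 (realisation \<omega>) t v = age V v0 (curry h) t v" for v
    using age_cong[of V "curry h" "realisation \<omega>" v0 t v] agree F_0[OF \<omega>] history_0 \<omega>' v0_in_V
    by simp
  have age': "age V v0 (realisation \<omega>') t v = age V v0 (curry h) t v" for v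
    using age_history[OF \<omega>'(1)] \<omega>'(2) by simp
  have "F v (min i (age V v0 (curry h) t v)) \<omega> = F v (min i (age V v0 (curry h) t v)) \<omega>'"
    if "v \<in> V" "i \<le> t" for v i
  proof -
    have "F v (min i (age V v0 (curry h) t v)) \<omega> = h (v, min i (age V v0 (curry h) t v))"
      using agree that by simp
    also have "\<dots> = F v (min i (age V v0 (curry h) t v)) \<omega>'"
      unfolding \<omega>'(2) using that age_history[OF \<omega>'(1), of t v] by (simp add: history_def min.coboundedI1)
    finally show ?thesis .
  qed
  then have "history t \<omega> = history t \<omega>'"
    unfolding history_def age age' by (intro restrict_ext) auto
  then show "history t \<omega> = h" using \<omega>'(2) by simp
qed

lemma history_event [measurable]: "{\<omega> \<in> space M. history t \<omega> = h} \<in> events"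
proof (cases "h \<in> history t ` space M")
  case True
  have "{\<omega> \<in> space M. \<forall>v\<in>V. \<forall>i\<in>{..age V v0 (curry h) t v}. F v i \<omega> = h (v, i)} \<in> events"
    using finite_V by (intro sets.sets_Collect_finite_All F_event) auto
  then show ?thesis using history_eq_iff[OF _ True] by (simp add: Ball_def cong: conj_cong)
next
  case False
  then have "{\<omega> \<in> space M. history t \<omega> = h} = {}" by auto
  then show ?thesis by (simp only: sets.empty_sets)
qed

lemma history_measurable: "history t \<in> measurable M (count_space ((V \<times> {..t}) \<rightarrow>\<^sub>E V))"
proof (subst measurable_count_space_eq2)
  show "finite ((V \<times> {..t}) \<rightarrow>\<^sub>E V)" using finite_V by (auto intro!: finite_PiE)
  have "history t -` {h} \<inter> space M = {\<omega> \<in> space M. history t \<omega> = h}" for h by auto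
  then show "history t \<in> space M \<rightarrow> (V \<times> {..t}) \<rightarrow>\<^sub>E V \<and>
      (\<forall>h\<in>(V \<times> {..t}) \<rightarrow>\<^sub>E V. history t -` {h} \<inter> space M \<in> events)"
    using history_PiE history_event by auto
qed

lemma awake_measurable [measurable]: "awake t \<in> measurable M (count_space UNIV)"
proof -
  have "(\<lambda>\<omega>. visited V v0 (curry (history t \<omega>)) t) \<in> measurable M (count_space UNIV)"
    by (rule measurable_compose[OF history_measurable]) simp
  then show ?thesis
    by (rule measurable_cong[THEN iffD1, rotated]) (simp add: visited_history)
qed

lemma awake_event: "{\<omega> \<in> space M. P (awake t \<omega>)} \<in> events"
proof -
  have "{\<omega> \<in> space M. P (awake t \<omega>)} = awake t -` {A. P A} \<inter> space M" by auto
  then show ?thesis using measurable_sets[OF awake_measurable, of "{A. P A}" t] by simp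
qed

section \<open>The next step of the awake set, given the history\<close>

lemma root_awake: "v0 \<in> awake t \<omega>"
  by (rule root_visited[OF v0_in_V])

lemma finite_awake: "finite (awake t \<omega>)"
  by (rule finite_subset[OF visited_subset finite_V])

lemma card_awake_pos: "card (awake t \<omega>) > 0"
  using root_awake[of \<omega> t] finite_awake[of \<omega> t] card_gt_0_iff[of "awake t \<omega>"] by auto

lemma card_awake_le: "card (awake t \<omega>) \<le> card V"
  by (rule card_mono[OF finite_V visited_subset])

lemma awake_Suc:
  assumes "\<omega> \<in> space M"
  shows "awake (Suc t) \<omega> =
    awake t \<omega> \<union> (\<lambda>v. F v (Suc (age V v0 (realisation \<omega>) t v)) \<omega>) ` awake t \<omega>"
proof -
  have "(\<lambda>v. F v (Suc t - the_enat (passage_time V (realisation \<omega>) v0 v)) \<omega>) ` awake t \<omega> =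
      (\<lambda>v. F v (Suc (age V v0 (realisation \<omega>) t v)) \<omega>) ` awake t \<omega>"
    by (intro image_cong refl) (simp add: Suc_age)
  moreover have "(\<lambda>v. F v (Suc (age V v0 (realisation \<omega>) t v)) \<omega>) ` awake t \<omega> \<subseteq> V"
    using F_in_V[OF _ assms] subsetD[OF visited_subset[of V v0 "realisation \<omega>" t]] by auto
  ultimately show ?thesis
    using visited_Suc[of V "realisation \<omega>" v0 t] F_0[OF assms] v0_in_V by (simp add: Int_absorb1)
qed

text \<open>The walk itself is a path to its current position. Hence no awake frog stands on a
  sleeping vertex, and each sleeping vertex is a possible target of the next step.\<close>

lemma position_awake:
  assumes \<omega>: "\<omega> \<in> space M" and v: "v \<in> awake t \<omega>"
  shows "F v (age V v0 (realisation \<omega>) t v) \<omega> \<in> awake t \<omega>"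
proof -
  obtain r where r: "passage_time V (realisation \<omega>) v0 v = enat r" "r \<le> t"
    using v by (rule visited_passage_time)
  have vV: "v \<in> V" by (rule subsetD[OF visited_subset v])
  let ?w = "F v (t - r) \<omega>"
  have "passage_time V (realisation \<omega>) v0 ?w \<le> enat r + hitting_time (realisation \<omega>) v ?w"
    using passage_time_triangle[of ?w V "realisation \<omega>" v0 v] F_in_V[OF vV \<omega>] r by simp
  also have "\<dots> \<le> enat r + enat (t - r)"
    by (intro add_left_mono hitting_time_le) simp
  finally show ?thesis using r v F_in_V[OF vV \<omega>] by (simp add: age_def) (simp add: visited_def)
qed

text \<open>Subtract the step to \<open>u\<close> from the event of the initial segment. As
  \<open>y m\<close> is a vertex other than \<open>u\<close>, the latter is one of
  \<open>card V - 1\<close> equally likely targets.\<close>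

lemma walk_avoids:
  assumes v: "v \<in> V" and u: "u \<in> V" and ym: "y m \<in> V" "y m \<noteq> u"
  shows "prob {\<omega> \<in> space M. (\<forall>i\<le>m. F v i \<omega> = y i) \<and> F v (Suc m) \<omega> \<noteq> u} =
    prob {\<omega> \<in> space M. \<forall>i\<le>m. F v i \<omega> = y i} * (1 - 1 / (real (card V) - 1))"
proof -
  note [measurable] = F_event[OF v]
  have S: "{\<omega> \<in> space M. \<forall>i\<le>m. F v i \<omega> = y i} \<in> events"
    by measurable
  have T: "{\<omega> \<in> space M. (\<forall>i\<le>m. F v i \<omega> = y i) \<and> F v (Suc m) \<omega> = u} \<in> events"
    by measurable
  have "{\<omega> \<in> space M. (\<forall>i\<le>m. F v i \<omega> = y i) \<and> F v (Suc m) \<omega> \<noteq> u} =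
      {\<omega> \<in> space M. \<forall>i\<le>m. F v i \<omega> = y i} -
      {\<omega> \<in> space M. (\<forall>i\<le>m. F v i \<omega> = y i) \<and> F v (Suc m) \<omega> = u}" by auto
  moreover have "prob {\<omega> \<in> space M. (\<forall>i\<le>m. F v i \<omega> = y i) \<and> F v (Suc m) \<omega> = u} =
      prob {\<omega> \<in> space M. \<forall>i\<le>m. F v i \<omega> = y i} * pmf (pmf_of_set (V - {y m})) u"
    by (rule srw[OF v, unfolded srw_complete_def, THEN conjunct2, THEN conjunct2, THEN spec, THEN spec, THEN spec])
  moreover have "pmf (pmf_of_set (V - {y m})) u = 1 / (real (card V) - 1)"
  proof (subst pmf_of_set)
    show "V - {y m} \<noteq> {}" using u ym by auto
    show "indicator (V - {y m}) u / real (card (V - {y m})) = 1 / (real (card V) - 1)"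
      using u ym finite_V card_V by (simp add: of_nat_diff)
  qed (use finite_V in auto)
  ultimately show ?thesis
    using finite_measure_Diff[OF S T] by (simp add: right_diff_distrib Collect_mono)
qed

text \<open>The fixed history and the avoidance of \<open>u\<close> both split into events about
  single walks. By independence each awake frog contributes one factor for missing \<open>u\<close>,
  and a sleeping frog contributes none.\<close>

lemma prob_stays_asleep:
  assumes h: "h \<in> history t ` space M" and u: "u \<in> V" "u \<notin> visited V v0 (curry h) t"
  shows "prob {\<omega> \<in> space M. history t \<omega> = h \<and> u \<notin> awake (Suc t) \<omega>} =
    prob {\<omega> \<in> space M. history t \<omega> = h} *
      (1 - 1 / (real (card V) - 1)) ^ card (visited V v0 (curry h) t)"
proof -
  let ?A = "visited V v0 (curry h) t" and ?m = "age V v0 (curry h) t"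
  let ?P = "Pi\<^sub>M UNIV (\<lambda>_::nat. count_space V)"
  \<comment> \<open>The flag \<open>b\<close> treats two events at once: \<open>False\<close> gives
    the history alone, \<open>True\<close> adds that the next step of each awake frog misses
    \<open>u\<close>.\<close>
  let ?Y = "\<lambda>b v. {x \<in> space ?P. (\<forall>i\<le>?m v. x i = h (v, i)) \<and> (b \<and> v \<in> ?A \<longrightarrow> x (Suc (?m v)) \<noteq> u)}"
  let ?E = "\<lambda>b v. {\<omega> \<in> space M. (\<forall>i\<le>?m v. F v i \<omega> = h (v, i)) \<and>
    (b \<and> v \<in> ?A \<longrightarrow> F v (Suc (?m v)) \<omega> \<noteq> u)}"
  have Y: "?Y b v \<in> sets ?P" for b v
    by measurable
  have pre: "(\<lambda>\<omega> t. F v t \<omega>) -` ?Y b v \<inter> space M = ?E b v" if "v \<in> V" for b v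
    using F_in_V[OF that] by (auto simp: space_PiM)
  have prod: "prob (\<Inter>v\<in>V. ?E b v) = (\<Prod>v\<in>V. prob (?E b v))" for b
  proof -
    define Z where "Z v = ?Y b v" for v
    define D where "D v = ?E b v" for v
    have D: "(\<lambda>\<omega> t. F v t \<omega>) -` Z v \<inter> space M = D v" if "v \<in> V" for v
      unfolding Z_def D_def by (rule pre[OF that])
    have Z: "Z v \<in> sets ?P" for v
      unfolding Z_def by (rule Y)
    have "prob (\<Inter>v\<in>V. (\<lambda>\<omega> t. F v t \<omega>) -` Z v \<inter> space M) =
        (\<Prod>v\<in>V. prob ((\<lambda>\<omega> t. F v t \<omega>) -` Z v \<inter> space M))"
      by (rule indep_varsD[OF indep V_nonempty finite_V subset_refl]) (rule Z)
    moreover have "(\<Inter>v\<in>V. (\<lambda>\<omega> t. F v t \<omega>) -` Z v \<inter> space M) = (\<Inter>v\<in>V. D v)"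
      by (rule INF_cong[OF refl D])
    moreover have "(\<Prod>v\<in>V. prob ((\<lambda>\<omega> t. F v t \<omega>) -` Z v \<inter> space M)) = (\<Prod>v\<in>V. prob (D v))"
      by (rule prod.cong[OF refl]) (simp only: D)
    ultimately have "prob (\<Inter>v\<in>V. D v) = (\<Prod>v\<in>V. prob (D v))" by (simp only:)
    then show ?thesis unfolding D_def .
  qed
  from h obtain \<omega>' where \<omega>': "\<omega>' \<in> space M" "h = history t \<omega>'" by auto
  have A: "?A = awake t \<omega>'" and m: "?m v = age V v0 (realisation \<omega>') t v" for v
    using visited_history age_history \<omega>' by auto
  have step: "prob (?E True v) = prob (?E False v) * (if v \<in> ?A then 1 - 1 / (real (card V) - 1) else 1)"
    if v: "v \<in> V" for v
  proof (cases "v \<in> ?A")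
    case True
    have "h (v, ?m v) = F v (?m v) \<omega>'"
      using history_agrees[of \<omega>' t] v \<omega>'(2) m by auto
    then have "h (v, ?m v) \<in> ?A"
      using position_awake[OF \<omega>'(1), of v t] True A m by simp
    then have "h (v, ?m v) \<noteq> u" "h (v, ?m v) \<in> V"
      using u subsetD[OF visited_subset[of V v0 "curry h" t]] by auto
    then show ?thesis
      using walk_avoids[of v u "\<lambda>i. h (v, i)" "?m v"] True v u by simp
  qed simp
  have False_eq: "{\<omega> \<in> space M. history t \<omega> = h} = (\<Inter>v\<in>V. ?E False v)"
  proof (intro set_eqI)
    fix \<omega>
    show "\<omega> \<in> {\<omega> \<in> space M. history t \<omega> = h} \<longleftrightarrow> \<omega> \<in> (\<Inter>v\<in>V. ?E False v)"
      using history_eq_iff[OF _ h, of \<omega>] v0_in_V by (cases "\<omega> \<in> space M") auto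
  qed
  moreover have "{\<omega> \<in> space M. history t \<omega> = h \<and> u \<notin> awake (Suc t) \<omega>} = (\<Inter>v\<in>V. ?E True v)"
  proof -
    have "u \<notin> awake (Suc t) \<omega> \<longleftrightarrow> (\<forall>v\<in>?A. F v (Suc (?m v)) \<omega> \<noteq> u)"
      if "\<omega> \<in> space M" "history t \<omega> = h" for \<omega>
    proof -
      have "awake t \<omega> = ?A" "\<And>v. age V v0 (realisation \<omega>) t v = ?m v"
        using visited_history[OF that(1), of t t] age_history[OF that(1), of t] that(2) by simp_all
      then have "awake (Suc t) \<omega> = ?A \<union> (\<lambda>v. F v (Suc (?m v)) \<omega>) ` ?A"
        using awake_Suc[OF that(1), of t] by simp
      then show ?thesis using u(2) by blast
    qed
    then have "{\<omega> \<in> space M. history t \<omega> = h \<and> u \<notin> awake (Suc t) \<omega>} =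
      {\<omega> \<in> space M. history t \<omega> = h} \<inter> {\<omega>. \<forall>v\<in>?A. F v (Suc (?m v)) \<omega> \<noteq> u}" by blast
    also have "\<dots> = (\<Inter>v\<in>V. ?E False v) \<inter> {\<omega>. \<forall>v\<in>?A. F v (Suc (?m v)) \<omega> \<noteq> u}"
      unfolding False_eq ..
    also have "\<dots> = (\<Inter>v\<in>V. ?E True v)"
      using visited_subset[of V v0 "curry h" t] by fast
    finally show ?thesis .
  qed
  moreover have "(\<Prod>v\<in>V. prob (?E True v)) =
      (\<Prod>v\<in>V. prob (?E False v)) * (\<Prod>v\<in>V. if v \<in> ?A then 1 - 1 / (real (card V) - 1) else 1)"
    unfolding prod.distrib[symmetric] by (intro prod.cong refl step)
  moreover have "(\<Prod>v\<in>V. if v \<in> ?A then 1 - 1 / (real (card V) - 1) else 1) =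
      (1 - 1 / (real (card V) - 1)) ^ card ?A"
    using finite_V visited_subset[of V v0 "curry h" t]
    by (simp add: prod.If_cases Int_absorb1 flip: Int_def)
  ultimately show ?thesis using prod[of True] prod[of False] by simp
qed


end

section \<open>The logistic potential\<close>

text \<open>Bernoulli's inequality gives
  \<open>(1 - x)^k (1 + k x) \<le> (1 - x\<^sup>2)^k \<le> 1\<close>, and
  \<open>1 / (1 + y) \<le> 1 - y / 2\<close> for \<open>y\<close> in \<open>[0, 1]\<close>.\<close>

lemma one_minus_power_ge:
  fixes x :: real
  assumes "0 \<le> x" "x \<le> 1" "real k * x \<le> 1"
  shows "real k * x / 2 \<le> 1 - (1 - x) ^ k"
proof -
  have "(1 - x) ^ k * (1 + real k * x) \<le> (1 - x) ^ k * (1 + x) ^ k"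
    using assms Bernoulli_inequality[of x k] by (intro mult_left_mono) auto
  also have "\<dots> = (1 - x\<^sup>2) ^ k"
    by (simp add: power_mult_distrib[symmetric] algebra_simps power2_eq_square)
  also have "\<dots> \<le> 1"
    using assms by (intro power_le_one) (auto simp: abs_square_le_1)
  finally have "(1 - x) ^ k \<le> 1 / (1 + real k * x)"
    using assms by (simp add: pos_le_divide_eq add_pos_nonneg)
  moreover have "1 / (1 + real k * x) \<le> 1 - real k * x / 2"
  proof -
    let ?y = "real k * x"
    have "0 \<le> ?y" using assms by simp
    moreover from this assms(3) have "?y * ?y \<le> ?y" by (simp add: mult_left_le)
    ultimately have "1 \<le> (1 - ?y / 2) * (1 + ?y)" by (simp add: algebra_simps)
    then show ?thesis using \<open>0 \<le> ?y\<close> by (simp add: divide_le_eq)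
  qed
  ultimately show ?thesis by simp
qed

text \<open>The convex function \<open>1 / k\<close> lies below its chord on \<open>[k, 2 k]\<close>.\<close>

lemma inverse_le_chord:
  fixes k x :: real
  assumes "k > 0" "0 \<le> x" "x \<le> k"
  shows "1 / (k + x) \<le> 1 / k - x / (2 * k\<^sup>2)"
proof -
  have "1 / k - x / (2 * k\<^sup>2) - 1 / (k + x) = x * (k - x) / (2 * k\<^sup>2 * (k + x))"
    using assms by (simp add: field_simps power2_eq_square)
  moreover have "\<dots> \<ge> 0" using assms by simp
  ultimately show ?thesis by linarith
qed

context frog_model
begin

text \<open>The ratio of sleeping to awake frogs, which decays exponentially along logistic
  growth.\<close>

definition potential :: "nat \<Rightarrow> real" where
  "potential k = real (card V) / real k - 1"

lemma potential_nonneg: "k \<le> card V \<Longrightarrow> k > 0 \<Longrightarrow> 0 \<le> potential k"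
  by (simp add: potential_def)

lemma potential_le: "k > 0 \<Longrightarrow> potential k \<le> card V"
  using divide_left_mono[of 1 "real k" "real (card V)"] by (simp add: potential_def)

lemma potential_awake_nonneg: "0 \<le> potential (card (awake t \<omega>))"
  by (intro potential_nonneg card_awake_le card_awake_pos)

lemma potential_measurable [measurable]: "(\<lambda>\<omega>. potential (card (awake t \<omega>))) \<in> borel_measurable M"
  by (rule measurable_compose[OF awake_measurable, of "\<lambda>A. potential (card A)"]) simp

lemma potential_integrable: "integrable M (\<lambda>\<omega>. potential (card (awake t \<omega>)))"
proof (rule integrable_const_bound)
  show "AE \<omega> in M. norm (potential (card (awake t \<omega>))) \<le> real (card V)"
    using potential_le[OF card_awake_pos] potential_awake_nonneg by (intro AE_I2) simp
qed measurable

text \<open>Law of total expectation over the finitely many histories, whose indicators sum to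
  \<open>1\<close> on the space.\<close>

lemma integral_split_history:
  fixes g :: "'w \<Rightarrow> real"
  assumes "integrable M g"
  shows "(\<integral>\<omega>. g \<omega> \<partial>M) =
    (\<Sum>h\<in>history t ` space M. \<integral>\<omega>. indicator {\<omega> \<in> space M. history t \<omega> = h} \<omega> * g \<omega> \<partial>M)"
proof -
  have "(\<integral>\<omega>. g \<omega> \<partial>M) =
      (\<integral>\<omega>. (\<Sum>h\<in>history t ` space M. indicator {\<omega> \<in> space M. history t \<omega> = h} \<omega> * g \<omega>) \<partial>M)"
  proof (intro Bochner_Integration.integral_cong refl)
    fix \<omega> assume \<omega>: "\<omega> \<in> space M"
    have "(\<Sum>h\<in>history t ` space M. indicator {\<omega> \<in> space M. history t \<omega> = h} \<omega> * g \<omega>) =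
        (\<Sum>h\<in>history t ` space M. if h = history t \<omega> then g \<omega> else 0)"
      using \<omega> by (intro sum.cong) (auto simp: indicator_def)
    then show "g \<omega> = (\<Sum>h\<in>history t ` space M. indicator {\<omega> \<in> space M. history t \<omega> = h} \<omega> * g \<omega>)"
      using \<omega> finite_histories[of t] by simp
  qed
  also have "\<dots> =
      (\<Sum>h\<in>history t ` space M. \<integral>\<omega>. indicator {\<omega> \<in> space M. history t \<omega> = h} \<omega> * g \<omega> \<partial>M)"
    by (intro Bochner_Integration.integral_sum)
      (subst mult.commute, rule integrable_real_mult_indicator[OF history_event assms])
  finally show ?thesis .
qed

text \<open>Drift estimate on one history event. The chord bound is linear in the number of newly
  woken frogs, so its expectation involves only the probability that each single vertex stays
  asleep.\<close>

lemma potential_step_on_history: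
  assumes h: "h \<in> history t ` space M"
  shows "(\<integral>\<omega>. indicator {\<omega> \<in> space M. history t \<omega> = h} \<omega> * potential (card (awake (Suc t) \<omega>)) \<partial>M) \<le>
    prob {\<omega> \<in> space M. history t \<omega> = h} * (3 / 4 * potential (card (visited V v0 (curry h) t)))"
proof -
  define A where "A = visited V v0 (curry h) t"
  define k where "k = real (card A)"
  define n where "n = real (card V)"
  let ?a = "{\<omega> \<in> space M. history t \<omega> = h}"
  let ?b = "\<lambda>u. {\<omega> \<in> space M. history t \<omega> = h \<and> u \<notin> awake (Suc t) \<omega>}"
  define q where "q = (1 - 1 / (n - 1)) ^ card A"
  from h obtain \<omega>' where \<omega>': "\<omega>' \<in> space M" "h = history t \<omega>'" by auto
  have A: "A = awake t \<omega>'" using visited_history \<omega>' by (simp add: A_def)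
  have k: "0 < k" "k \<le> n" using card_awake_pos card_awake_le A by (auto simp: k_def n_def)
  have n: "n \<ge> 2" using card_V by (simp add: n_def)
  have AV: "A \<subseteq> V" "finite A" unfolding A by (rule visited_subset, rule finite_awake)
  have b: "?b u \<in> events" for u
    by (intro sets.sets_Collect_conj history_event awake_event)
  have cardVA: "real (card (V - A)) = n - k"
    using AV finite_V by (simp add: card_Diff_subset card_mono of_nat_diff k_def n_def)
  \<comment> \<open>The chord bound, with the newly woken vertices counted by indicators: each
    difference is the indicator that the history is \<open>h\<close> and \<open>u\<close> is awake
    at \<open>Suc t\<close>.\<close>
  let ?g = "\<lambda>\<omega>. indicator ?a \<omega> * (n / k - 1) -
      n / (2 * k\<^sup>2) * (\<Sum>u\<in>V - A. indicator ?a \<omega> - indicator (?b u) \<omega>)"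
  have g: "has_bochner_integral M ?g
      (prob ?a * (n / k - 1) - n / (2 * k\<^sup>2) * (\<Sum>u\<in>V - A. prob ?a - prob (?b u)))"
    by (intro has_bochner_integral_diff has_bochner_integral_mult_left has_bochner_integral_mult_right
        has_bochner_integral_sum has_bochner_integral_real_indicator)
      (simp_all add: b emeasure_eq_measure)
  have "(\<integral>\<omega>. indicator ?a \<omega> * potential (card (awake (Suc t) \<omega>)) \<partial>M) \<le> (\<integral>\<omega>. ?g \<omega> \<partial>M)"
  proof (rule integral_mono[OF _ integrable.intros[OF g]])
    show "integrable M (\<lambda>\<omega>. indicator ?a \<omega> * potential (card (awake (Suc t) \<omega>)))"
      using integrable_real_mult_indicator[OF history_event[where t = t and h = h]
          potential_integrable[where t = "Suc t"]]
      by (simp add: mult.commute)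
    fix \<omega> assume \<omega>: "\<omega> \<in> space M"
    show "indicator ?a \<omega> * potential (card (awake (Suc t) \<omega>)) \<le> ?g \<omega>"
    proof (cases "history t \<omega> = h")
      case False
      then show ?thesis by (simp add: indicator_def)
    next
      case True
      let ?B = "awake (Suc t) \<omega>"
      have At: "A = awake t \<omega>" using visited_history[OF \<omega>, of t t] True by (simp add: A_def)
      have AB: "A \<subseteq> ?B" "?B \<subseteq> V" unfolding At by (simp_all add: visited_mono visited_subset)
      define x where "x = real (card ?B) - k"
      have x0: "0 \<le> x" using card_mono[OF finite_awake AB(1)] by (simp add: x_def k_def)
      have xk: "x \<le> k"
        using card_visited_Suc_le[of V "realisation \<omega>" v0 t] F_0[OF \<omega>] v0_in_V finite_V
        unfolding x_def k_def At by simp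
      have "(\<Sum>u\<in>V - A. indicator ?a \<omega> - indicator (?b u) \<omega>) =
          (\<Sum>u\<in>V - A. if u \<in> ?B - A then 1 else 0 :: real)"
        using \<omega> True by (intro sum.cong) (auto simp: indicator_def)
      also have "\<dots> = real (card (?B - A))"
      proof -
        have "(V - A) \<inter> (?B - A) = ?B - A" using AB by auto
        then show ?thesis using finite_V by (simp only: sum.inter_restrict[symmetric] finite_Diff) simp
      qed
      also have "\<dots> = x"
        using AB AV card_mono[OF finite_awake AB(1)] by (simp add: card_Diff_subset of_nat_diff x_def k_def)
      finally have "?g \<omega> = n / k - 1 - n / (2 * k\<^sup>2) * x"
        using \<omega> True by (simp add: indicator_def)
      also have "\<dots> = n * (1 / k - x / (2 * k\<^sup>2)) - 1" by (simp add: algebra_simps)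
      also have "\<dots> \<ge> n * (1 / (k + x)) - 1"
        using inverse_le_chord[OF k(1) x0 xk] n by (intro diff_right_mono mult_left_mono) auto
      finally show ?thesis
        using \<omega> True by (simp add: indicator_def potential_def n_def x_def)
    qed
  qed
  also have "(\<integral>\<omega>. ?g \<omega> \<partial>M) = prob ?a * (n / k - 1) - n / (2 * k\<^sup>2) * (\<Sum>u\<in>V - A. prob ?a - prob (?b u))"
    by (rule has_bochner_integral_integral_eq[OF g])
  also have "(\<Sum>u\<in>V - A. prob ?a - prob (?b u)) = (\<Sum>u\<in>V - A. prob ?a * (1 - q))"
    using prob_stays_asleep[OF h] by (intro sum.cong) (auto simp: A_def q_def n_def algebra_simps)
  also have "\<dots> = (n - k) * (prob ?a * (1 - q))"
    by (simp add: cardVA)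
  also have "prob ?a * (n / k - 1) - n / (2 * k\<^sup>2) * ((n - k) * (prob ?a * (1 - q))) =
      prob ?a * (n / k - 1 - n / (2 * k\<^sup>2) * (n - k) * (1 - q))"
    by (simp only: right_diff_distrib mult_ac)
  also have "\<dots> \<le> prob ?a * (3 / 4 * (n / k - 1))"
  proof (intro mult_left_mono)
    show "n / k - 1 - n / (2 * k\<^sup>2) * (n - k) * (1 - q) \<le> 3 / 4 * (n / k - 1)"
    \<comment> \<open>At \<open>k = n\<close> both sides vanish. Otherwise
      \<open>k \<le> n - 1\<close>, which is the condition \<open>k x \<le> 1\<close> for
      \<open>x = 1 / (n - 1)\<close>.\<close>
    proof (cases "k = n")
      case False
      then have "card A < card V" using k unfolding k_def n_def by simp
      then have kn: "k \<le> n - 1" unfolding k_def n_def by simp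
      have "k * (1 / (n - 1)) / 2 \<le> 1 - q"
        using one_minus_power_ge[of "1 / (n - 1)" "card A"] kn n by (simp add: q_def k_def)
      \<comment> \<open>Weakening \<open>n - 1\<close> to \<open>n\<close> makes the guaranteed
        decrement exactly a quarter of \<open>n / k - 1\<close>.\<close>
      moreover have "k / (2 * n) \<le> k / (2 * (n - 1))"
        using k n by (intro divide_left_mono) auto
      ultimately have "k / (2 * n) \<le> 1 - q" by (simp add: mult.commute)
      then have "n / (2 * k\<^sup>2) * (n - k) * (k / (2 * n)) \<le> n / (2 * k\<^sup>2) * (n - k) * (1 - q)"
        using k n by (intro mult_left_mono) auto
      moreover have "n / (2 * k\<^sup>2) * (n - k) * (k / (2 * n)) = 1 / 4 * (n / k - 1)"
        using k n by (simp add: field_simps power2_eq_square)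
      moreover have "c - b \<le> 3 / 4 * c" if "a \<le> b" "a = 1 / 4 * c" for a b c :: real
        using that by linarith
      ultimately show ?thesis by blast
    qed (use k in simp)
  qed simp
  also have "n / k - 1 = potential (card A)" by (simp add: potential_def n_def k_def)
  finally show ?thesis unfolding A_def .
qed

text \<open>Sum the drift estimate over all histories; the potential at time \<open>t\<close> is
  constant on each history event.\<close>

lemma expected_potential_Suc:
  "(\<integral>\<omega>. potential (card (awake (Suc t) \<omega>)) \<partial>M) \<le> 3 / 4 * (\<integral>\<omega>. potential (card (awake t \<omega>)) \<partial>M)"
proof -
  have "(\<integral>\<omega>. potential (card (awake (Suc t) \<omega>)) \<partial>M) \<le>
      (\<Sum>h\<in>history t ` space M. prob {\<omega> \<in> space M. history t \<omega> = h} *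
        (3 / 4 * potential (card (visited V v0 (curry h) t))))"
    unfolding integral_split_history[OF potential_integrable, of "Suc t" t]
    by (intro sum_mono potential_step_on_history)
  also have "\<dots> = 3 / 4 * (\<Sum>h\<in>history t ` space M.
      \<integral>\<omega>. indicator {\<omega> \<in> space M. history t \<omega> = h} \<omega> * potential (card (awake t \<omega>)) \<partial>M)"
    unfolding sum_distrib_left
  proof (intro sum.cong refl)
    fix h
    have "(\<integral>\<omega>. indicator {\<omega> \<in> space M. history t \<omega> = h} \<omega> * potential (card (awake t \<omega>)) \<partial>M) =
      (\<integral>\<omega>. indicator {\<omega> \<in> space M. history t \<omega> = h} \<omega> * potential (card (visited V v0 (curry h) t)) \<partial>M)"
    proof (intro Bochner_Integration.integral_cong refl)
      fix \<omega> assume "\<omega> \<in> space M"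
      from visited_history[OF this, of t t]
      show "indicator {\<omega> \<in> space M. history t \<omega> = h} \<omega> * potential (card (awake t \<omega>)) =
        indicator {\<omega> \<in> space M. history t \<omega> = h} \<omega> * potential (card (visited V v0 (curry h) t))"
        by (cases "history t \<omega> = h") simp_all
    qed
    then show "prob {\<omega> \<in> space M. history t \<omega> = h} * (3 / 4 * potential (card (visited V v0 (curry h) t))) =
      3 / 4 * (\<integral>\<omega>. indicator {\<omega> \<in> space M. history t \<omega> = h} \<omega> * potential (card (awake t \<omega>)) \<partial>M)"
      by simp
  qed
  also have "\<dots> = 3 / 4 * (\<integral>\<omega>. potential (card (awake t \<omega>)) \<partial>M)"
    unfolding integral_split_history[OF potential_integrable, of t t] ..
  finally show ?thesis .
qed

lemma expected_potential_le:
  "(\<integral>\<omega>. potential (card (awake t \<omega>)) \<partial>M) \<le> (3 / 4) ^ t * card V"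
proof (induction t)
  case 0
  have "(\<integral>\<omega>. potential (card (awake 0 \<omega>)) \<partial>M) \<le> (\<integral>\<omega>. real (card V) \<partial>M)"
    by (intro integral_mono potential_integrable potential_le card_awake_pos) simp
  then show ?case by (simp add: prob_space)
next
  case (Suc t)
  then show ?case using expected_potential_Suc[of t] by simp
qed

text \<open>Markov's inequality: \<open>n\<close> times the potential is at least \<open>1\<close>
  while some frog sleeps, and nonnegative always.\<close>

lemma prob_not_all_awake_le:
  "prob {\<omega> \<in> space M. card (awake t \<omega>) \<noteq> card V} \<le> (real (card V))\<^sup>2 * (3 / 4) ^ t"
proof -
  let ?n = "real (card V)"
  let ?E = "{\<omega> \<in> space M. card (awake t \<omega>) \<noteq> card V}"
  have E: "?E \<in> events" by (rule awake_event)
  have "prob ?E = (\<integral>\<omega>. indicator ?E \<omega> \<partial>M)" using E by simp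
  also have "\<dots> \<le> (\<integral>\<omega>. ?n * potential (card (awake t \<omega>)) \<partial>M)"
  proof (intro integral_mono)
    show "integrable M (indicator ?E :: 'w \<Rightarrow> real)" 
      using E by (simp add: emeasure_eq_measure)
    show "integrable M (\<lambda>\<omega>. ?n * potential (card (awake t \<omega>)))"
      using potential_integrable by simp
    fix \<omega> assume "\<omega> \<in> space M"
    show "indicator ?E \<omega> \<le> ?n * potential (card (awake t \<omega>))"
    proof (cases "card (awake t \<omega>) = card V")
      case False
      let ?k = "real (card (awake t \<omega>))"
      have k: "?k + 1 \<le> ?n" "?k > 0"
        using False card_awake_le[of \<omega> t] card_awake_pos[of \<omega> t] by auto
      then have "?k \<le> ?n * (?n - ?k)" using mult_mono[of ?k ?n 1 "?n - ?k"] by simp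
      then have "1 \<le> ?n * (?n / ?k - 1)" using k by (simp add: field_simps)
      then show ?thesis by (simp add: potential_def indicator_def)
    next
      case True
      then show ?thesis using potential_awake_nonneg[of \<omega> t] by (simp add: indicator_def)
    qed
  qed
  also have "\<dots> \<le> ?n * ((3 / 4) ^ t * ?n)"
    using expected_potential_le[of t] by (simp add: mult_left_mono)
  finally show ?thesis by (simp add: power2_eq_square mult_ac)
qed

section \<open>The expected wakeup time\<close>

text \<open>Every \<open>t\<close> before the wakeup time contributes \<open>1\<close>. Comparing
  the sum with each natural \<open>r\<close> not above the wakeup time also covers the infinite
  case, where the sum dominates all naturals.\<close>

lemma wakeup_time_le_suminf:
  "ennreal_of_enat (wakeup_time V v0 (realisation \<omega>)) \<le>
    (\<Sum>t. of_bool (card (awake t \<omega>) \<noteq> card V))"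
proof (rule ccontr)
  let ?T = "wakeup_time V v0 (realisation \<omega>)"
  have "of_nat r \<le> (\<Sum>t. of_bool (card (awake t \<omega>) \<noteq> card V) :: ennreal)" if "enat r \<le> ?T" for r
  proof -
    have "card (awake t \<omega>) \<noteq> card V" if "t < r" for t
    proof
      assume "card (awake t \<omega>) = card V"
      then have "?T \<le> enat t" unfolding wakeup_time_def by (intro Inf_lower) auto
      then show False using \<open>enat r \<le> ?T\<close> \<open>t < r\<close> by (meson enat_ord_simps(1) leD order_trans)
    qed
    then have "of_nat r = (\<Sum>t<r. of_bool (card (awake t \<omega>) \<noteq> card V) :: ennreal)" by simp
    also have "\<dots> \<le> (\<Sum>t. of_bool (card (awake t \<omega>) \<noteq> card V))"
      by (rule sum_le_suminf) auto
    finally show ?thesis .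
  qed
  note ge = this
  assume less: "\<not> ?thesis"
  show False
  proof (cases ?T)
    case infinity
    then have "of_nat r \<le> (\<Sum>t. of_bool (card (awake t \<omega>) \<noteq> card V) :: ennreal)" for r
      using ge by simp
    then have "(\<Sum>t. of_bool (card (awake t \<omega>) \<noteq> card V) :: ennreal) = \<infinity>"
      by (metis ennreal_Ex_less_of_nat infinity_ennreal_def leD top.not_eq_extremum)
    then show ?thesis using less by simp
  next
    case (enat r)
    then show ?thesis using less ge[of r] by simp
  qed
qed

lemma expected_wakeup_time_le:
  "expected_wakeup_time M V v0 F \<le> ennreal (2 / ln (4 / 3) * ln (card V) + 5)"
proof -
  define n where "n = real (card V)"
  \<comment> \<open>\<open>L\<close> is twice the logarithm of \<open>n\<close> to base
    \<open>4/3\<close>, the point where \<open>n\<^sup>2 (3/4)^L = 1\<close>; from there on the tail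
    bound is no worse than the trivial bound \<open>1\<close>.\<close>
  define L where "L = 2 / ln (4 / 3) * ln n"
  define s where "s = nat \<lceil>L\<rceil>"
  define f where "f t = (if t < s then 1 else n\<^sup>2 * (3 / 4) ^ t)" for t
  have n: "n \<ge> 2" using card_V by (simp add: n_def)
  have ln43: "ln (4 / 3 :: real) > 0" by simp
  have L0: "L \<ge> 0" using n ln43 by (simp add: L_def)
  have s: "L \<le> s" "s \<le> L + 1" unfolding s_def using L0 by linarith+
  have "(\<lambda>i. f (i + s)) = (\<lambda>i. n\<^sup>2 * (3 / 4) ^ s * (3 / 4) ^ i)"
    by (auto simp: f_def power_add)
  moreover have "\<dots> sums (n\<^sup>2 * (3 / 4) ^ s * (1 / (1 - 3 / 4)))"
    by (intro sums_mult geometric_sums) simp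
  ultimately have "f sums (n\<^sup>2 * (3 / 4) ^ s * 4 + (\<Sum>i<s. f i))"
    using sums_iff_shift[of f s] by simp
  moreover have "(\<Sum>i<s. f i) = s" by (simp add: f_def)
  moreover have "n\<^sup>2 * (3 / 4) ^ s \<le> 1"
  proof -
    have "n\<^sup>2 = exp (2 * ln n)" using n by (simp add: exp_double)
    also have "\<dots> = exp (L * ln (4 / 3))" using ln43 by (simp add: L_def)
    also have "\<dots> \<le> exp (s * ln (4 / 3))" using s ln43 by simp
    also have "\<dots> = (4 / 3) ^ s" by (simp add: exp_of_nat_mult)
    finally have "n\<^sup>2 * (3 / 4) ^ s \<le> (4 / 3) ^ s * (3 / 4) ^ s" by (intro mult_right_mono) auto
    also have "\<dots> = 1" by (simp flip: power_mult_distrib)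
    finally show ?thesis .
  qed
  \<comment> \<open>The first \<open>s\<close> terms give at most \<open>L + 1\<close> and the
    geometric tail at most \<open>4\<close>, hence the constant \<open>5\<close>.\<close>
  ultimately have f: "summable f" "suminf f \<le> L + 5"
    using s by (auto simp: sums_iff)
  have f0: "0 \<le> f t" for t by (simp add: f_def)
  have "expected_wakeup_time M V v0 F \<le>
      (\<integral>\<^sup>+\<omega>. (\<Sum>t. of_bool (card (awake t \<omega>) \<noteq> card V)) \<partial>M)"
    unfolding expected_wakeup_time_def by (intro nn_integral_mono wakeup_time_le_suminf)
  also have "\<dots> = (\<Sum>t. \<integral>\<^sup>+\<omega>. of_bool (card (awake t \<omega>) \<noteq> card V) \<partial>M)"
    by (intro nn_integral_suminf measurable_compose[OF awake_measurable]) simp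
  also have "\<dots> = (\<Sum>t. ennreal (prob {\<omega> \<in> space M. card (awake t \<omega>) \<noteq> card V}))"
  proof (intro suminf_cong)
    fix t
    have "(\<integral>\<^sup>+\<omega>. of_bool (card (awake t \<omega>) \<noteq> card V) \<partial>M) =
        (\<integral>\<^sup>+\<omega>. indicator {\<omega> \<in> space M. card (awake t \<omega>) \<noteq> card V} \<omega> \<partial>M)"
      by (intro nn_integral_cong) (auto simp: indicator_def)
    also have "\<dots> = ennreal (prob {\<omega> \<in> space M. card (awake t \<omega>) \<noteq> card V})"
      by (subst nn_integral_indicator) (simp_all add: awake_event emeasure_eq_measure)
    finally show "(\<integral>\<^sup>+\<omega>. of_bool (card (awake t \<omega>) \<noteq> card V) \<partial>M) =
      ennreal (prob {\<omega> \<in> space M. card (awake t \<omega>) \<noteq> card V})" .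
  qed
  also have "\<dots> \<le> (\<Sum>t. ennreal (f t))"
    using prob_not_all_awake_le prob_le_1
    by (intro suminf_le ennreal_leI) (auto simp: f_def n_def)
  also have "\<dots> = ennreal (suminf f)"
    by (rule suminf_ennreal2[OF f0 f(1)])
  also have "\<dots> \<le> ennreal (L + 5)" using f(2) by (rule ennreal_leI)
  finally show ?thesis by (simp add: L_def n_def)
qed

text \<open>The bound holds pointwise: having all vertices awake at time \<open>s\<close> forces
  \<open>card V \<le> 2 ^ s\<close> by doubling, and an infinite wakeup time is trivial.\<close>

lemma expected_wakeup_time_ge:
  "ennreal (ln (card V) / ln 2) \<le> expected_wakeup_time M V v0 F"
proof -
  have "ennreal (ln (card V) / ln 2) \<le> ennreal_of_enat (wakeup_time V v0 (realisation \<omega>))"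
    if \<omega>: "\<omega> \<in> space M" for \<omega>
  proof (cases "wakeup_time V v0 (realisation \<omega>)")
    case (enat s)
    have "card (awake s \<omega>) = card V"
      using Inf_enat_eqD[OF enat[unfolded wakeup_time_def]] by auto
    then have "card V \<le> 2 ^ s"
      using card_visited_le[of V "realisation \<omega>" v0 s] F_0[OF \<omega>] v0_in_V finite_V by simp
    then have "real (card V) \<le> 2 ^ s" by (simp flip: of_nat_power)
    then have "ln (real (card V)) \<le> ln (2 ^ s)" using card_V by (subst ln_le_cancel_iff) auto
    then have "ln (real (card V)) / ln 2 \<le> s" by (simp add: ln_realpow divide_le_eq)
    then have "ennreal (ln (card V) / ln 2) \<le> ennreal s" by (rule ennreal_leI)
    then show ?thesis using enat by (simp add: ennreal_of_nat_eq_real_of_nat)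
  qed simp
  then have "(\<integral>\<^sup>+\<omega>. ennreal (ln (card V) / ln 2) \<partial>M) \<le> expected_wakeup_time M V v0 F"
    unfolding expected_wakeup_time_def by (intro nn_integral_mono)
  then show ?thesis by (simp add: emeasure_space_1)
qed

end

section \<open>From bounds at each \<open>n\<close> to the order of growth\<close>

theorem theorem1:
  fixes M :: "nat \<Rightarrow> 'w measure" and V :: "nat \<Rightarrow> 'v set" and v0 :: "nat \<Rightarrow> 'v"
    and F :: "nat \<Rightarrow> 'v \<Rightarrow> nat \<Rightarrow> 'w \<Rightarrow> 'v"
  assumes "\<And>n. n \<ge> 2 \<Longrightarrow> frog_model (M n) (V n) (v0 n) (F n)"
    and "\<And>n. n \<ge> 2 \<Longrightarrow> card (V n) = n"
  shows "(\<forall>\<^sub>F n in sequentially. expected_wakeup_time (M n) (V n) (v0 n) (F n) < \<infinity>) \<and>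
         (\<lambda>n. enn2real (expected_wakeup_time (M n) (V n) (v0 n) (F n))) \<in> \<Theta>(\<lambda>n. ln (real n))"
proof -
  let ?E = "\<lambda>n. expected_wakeup_time (M n) (V n) (v0 n) (F n)"
  \<comment> \<open>The additive \<open>5\<close> of the upper bound is absorbed through
    \<open>ln n \<ge> ln 2\<close> for \<open>n \<ge> 2\<close>.\<close>
  let ?c = "2 / ln (4 / 3) + 5 / ln 2 :: real"
  have upper: "?E n \<le> ennreal (2 / ln (4 / 3) * ln n + 5)" if "n \<ge> 2" for n
    using frog_model.expected_wakeup_time_le[OF assms(1)[OF that]] assms(2)[OF that] by simp
  have lower: "ennreal (ln n / ln 2) \<le> ?E n" if "n \<ge> 2" for n
    using frog_model.expected_wakeup_time_ge[OF assms(1)[OF that]] assms(2)[OF that] by simp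
  \<comment> \<open>\<open>enn2real\<close> sends infinity to \<open>0\<close>, so the lower bound
    transfers to the reals only once finiteness is known.\<close>
  have fin: "?E n < \<infinity>" if "n \<ge> 2" for n
    using upper[OF that] by (simp add: le_less_trans)
  have ln2: "ln 2 \<le> ln (real n)" if "n \<ge> 2" for n :: nat
    using that by (subst ln_le_cancel_iff) auto
  have up: "enn2real (?E n) \<le> ?c * ln n" if "n \<ge> 2" for n
  proof -
    have "enn2real (?E n) \<le> 2 / ln (4 / 3) * ln n + 5"
      using upper[OF that] that by (intro enn2real_leI) auto
    also have "5 \<le> 5 / ln 2 * ln n"
      using ln2[OF that] by (simp add: field_simps)
    finally show ?thesis by (simp add: algebra_simps)
  qed
  have low: "ln n \<le> ln 2 * enn2real (?E n)" if "n \<ge> 2" for n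
  proof -
    have "ln n / ln 2 \<le> enn2real (?E n)"
      using enn2real_mono[OF lower[OF that]] fin[OF that] that by simp
    then show ?thesis by (simp add: divide_le_eq mult.commute)
  qed
  have "(\<lambda>n. enn2real (?E n)) \<in> O(\<lambda>n. ln (real n))"
  proof (rule bigoI, rule eventually_sequentiallyI)
    fix n :: nat assume "n \<ge> 2"
    then show "norm (enn2real (?E n)) \<le> ?c * norm (ln (real n))"
      using up[of n] by (simp only: real_norm_def abs_of_nonneg[OF enn2real_nonneg]) simp
  qed
  moreover have "(\<lambda>n. ln (real n)) \<in> O(\<lambda>n. enn2real (?E n))"
  proof (rule bigoI, rule eventually_sequentiallyI)
    fix n :: nat assume "n \<ge> 2"
    then show "norm (ln (real n)) \<le> ln 2 * norm (enn2real (?E n))"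
      using low[of n] by simp
  qed
  moreover have "\<forall>\<^sub>F n in sequentially. ?E n < \<infinity>"
    using fin by (rule eventually_sequentiallyI)
  ultimately show ?thesis using bigthetaI bigomega_iff_bigo by blast
qed

end
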